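(* Let $x_0\in\mathbb{R}^{n_1}$, $y_0\in\mathbb{R}^{n_2}$, $X\in\mathbb{R}^{m\times n_1}$, $Y\in\mathbb{R}^{m\times n_2}$ be entrywise nonnegative. Let $r=1+\delta^*$, where $\delta^*$ is the optimal value of the linear program $$\max\ \delta\quad\text{subject to}\quad y_0^T\tilde u\ge 1+\delta,\ \ x_0^T\tilde v\le 1-\delta,\ \ Y\tilde u-X\tilde v\le 0,\ \ \tilde u,\tilde v\ge 0,$$ in the variables $\delta\in\mathbb{R}$, $\tilde u\in\mathbb{R}^{n_2}$, $\tilde v\in\mathbb{R}^{n_1}$. Then: (1) $r\in[0,2]$; (2) $r\ge 1$ if and only if $\mathrm{DMU}_0$ is efficient; (3) $r<1$ if and only if $\mathrm{DMU}_0$ is inefficient.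
   Context: The data $(x_0,y_0,X,Y)$ consist of the input vector $x_0$ and output vector $y_0$ of the decision making unit $\mathrm{DMU}_0$, and the matrices $X$, $Y$ whose $i$th rows are the input and output vectors of the $i$th of the $m$ other decision making units. Vector inequalities are entrywise. $\mathrm{DMU}_0$ is called efficient if the optimal value of the linear program $\max\ y_0^Tu$ subject to $x_0^Tv\le 1$, $Yu-Xv\le 0$, $u,v\ge 0$ is at least $1$; equivalently, if the system $y_0^Tu\ge 1$, $x_0^Tv\le 1$, $Yu-Xv\le 0$, $u,v\ge 0$ is feasible. Otherwise it is inefficient. *)

theory Defs
  imports "HOL-Analysis.Analysis"
begin

text \<open>
  The optimal value of a maximisation problem lives in the extended reals, so that it is
  \<open>\<infinity>\<close> for an unbounded problem and \<open>- \<infinity>\<close> for an infeasible one.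
\<close>

definition opt_value :: "'a set \<Rightarrow> ('a \<Rightarrow> real) \<Rightarrow> ereal" where
  "opt_value S f = (SUP z\<in>S. ereal (f z))"

text \<open>
  The orders on vectors and matrices are the entrywise ones (\<open>less_eq_vec_def\<close>).
  The index type \<open>'m\<close> ranges over the other decision making units; row \<open>i\<close> of \<open>X\<close>
  and of \<open>Y\<close> is the input and output vector of unit \<open>i\<close>.
\<close>

definition efficiency_lp ::
  "real ^ 'n1 \<Rightarrow> real ^ 'n1 ^ 'm \<Rightarrow> real ^ 'n2 ^ 'm \<Rightarrow> ((real ^ 'n2) \<times> (real ^ 'n1)) set" where
  "efficiency_lp x0 X Y = {(u, v). x0 \<bullet> v \<le> 1 \<and> Y *v u - X *v v \<le> 0 \<and> 0 \<le> u \<and> 0 \<le> v}"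

text \<open>
  The value is \<open>\<infinity>\<close>, and the unit efficient, when this program is unbounded,
  for instance when \<open>x0 = 0\<close>, \<open>y0\<close> is nonzero and all entries of \<open>X\<close> are positive.
\<close>

definition efficient ::
  "real ^ 'n1 \<Rightarrow> real ^ 'n2 \<Rightarrow> real ^ 'n1 ^ 'm \<Rightarrow> real ^ 'n2 ^ 'm \<Rightarrow> bool" where
  "efficient x0 y0 X Y \<longleftrightarrow> opt_value (efficiency_lp x0 X Y) (\<lambda>(u, v). y0 \<bullet> u) \<ge> 1"

definition inefficient ::
  "real ^ 'n1 \<Rightarrow> real ^ 'n2 \<Rightarrow> real ^ 'n1 ^ 'm \<Rightarrow> real ^ 'n2 ^ 'm \<Rightarrow> bool" where
  "inefficient x0 y0 X Y \<longleftrightarrow> \<not> efficient x0 y0 X Y"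

definition delta_lp ::
  "real ^ 'n1 \<Rightarrow> real ^ 'n2 \<Rightarrow> real ^ 'n1 ^ 'm \<Rightarrow> real ^ 'n2 ^ 'm
    \<Rightarrow> (real \<times> (real ^ 'n2) \<times> (real ^ 'n1)) set" where
  "delta_lp x0 y0 X Y =
     {(\<delta>, u, v). y0 \<bullet> u \<ge> 1 + \<delta> \<and> x0 \<bullet> v \<le> 1 - \<delta> \<and> Y *v u - X *v v \<le> 0 \<and> 0 \<le> u \<and> 0 \<le> v}"

definition delta_star ::
  "real ^ 'n1 \<Rightarrow> real ^ 'n2 \<Rightarrow> real ^ 'n1 ^ 'm \<Rightarrow> real ^ 'n2 ^ 'm \<Rightarrow> ereal" where
  "delta_star x0 y0 X Y = opt_value (delta_lp x0 y0 X Y) (\<lambda>(\<delta>, u, v). \<delta>)"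

end

theory Submission
  imports Defs
begin

text \<open>
  The bounds on \<open>r\<close> say that \<open>- 1 \<le> \<delta>\<^sup>* \<le> 1\<close>: the point \<open>\<delta> = - 1\<close>, \<open>u = v = 0\<close> is feasible, and
  \<open>0 \<le> x0 \<bullet> v \<le> 1 - \<delta>\<close> caps \<open>\<delta>\<close> at \<open>1\<close>.

  The equivalence compares the efficiency program with the \<open>\<delta>\<close> program by rescaling. Their common constraints
  \<open>Y *v u - X *v v \<le> 0\<close>, \<open>0 \<le> u\<close>, \<open>0 \<le> v\<close> describe a cone, so a point feasible for the \<open>\<delta>\<close>
  program with \<open>\<delta> \<ge> - e\<close> (\<open>e > 0\<close>) becomes feasible for the efficiency program when divided by \<open>1 + e\<close>, and
  its output value is then at least \<open>(1 - e) / (1 + e) \<ge> 1 - 2 * e\<close>. Conversely a point of the efficiency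
  program with value at least \<open>1 - e\<close> is feasible for the \<open>\<delta>\<close> program with \<open>\<delta> = - e\<close>. Letting \<open>e\<close> tend to \<open>0\<close>
  identifies \<open>\<delta>\<^sup>* \<ge> 0\<close> with efficiency. Arguing with near-optimal points throughout avoids
  the question whether the optima are attained, and covers the unbounded case.
\<close>

text \<open>
  The form in which optimal values enter the comparison: near-optimal points witness a lower
  bound, also when the value is infinite or not attained.
\<close>

lemma le_opt_value_iff:
  "ereal c \<le> opt_value S f \<longleftrightarrow> (\<forall>e>0. \<exists>z\<in>S. c - e \<le> f z)"
proof
  assume "ereal c \<le> opt_value S f"
  then have near: "\<forall>y<ereal c. \<exists>z\<in>S. y < ereal (f z)"
    unfolding opt_value_def le_SUP_iff .
  have "\<exists>z\<in>S. ereal (c - e) < ereal (f z)" if "e > 0" for e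
  proof -
    have "ereal (c - e) < ereal c"
      using that by simp
    with near show ?thesis
      by blast
  qed
  then show "\<forall>e>0. \<exists>z\<in>S. c - e \<le> f z"
    by (metis less_ereal.simps(1) less_imp_le)
next
  assume near: "\<forall>e>0. \<exists>z\<in>S. c - e \<le> f z"
  show "ereal c \<le> opt_value S f"
  proof (rule ereal_le_epsilon2)
    fix e :: real
    assume "0 < e"
    with near obtain z where "z \<in> S" "c - e \<le> f z" by blast
    from \<open>z \<in> S\<close> have "ereal (f z) \<le> opt_value S f"
      unfolding opt_value_def by (rule SUP_upper)
    with \<open>c - e \<le> f z\<close> have "ereal (c - e) \<le> opt_value S f"
      by (meson ereal_less_eq(3) order_trans)
    then show "ereal c \<le> opt_value S f + ereal e"
      by (cases "opt_value S f") auto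
  qed
qed

lemma efficiency_lp_imp_delta_lp:
  assumes "(u, v) \<in> efficiency_lp x0 X Y" and "1 - e \<le> y0 \<bullet> u" and "0 \<le> e"
  shows "(- e, u, v) \<in> delta_lp x0 y0 X Y"
  using assms by (auto simp: efficiency_lp_def delta_lp_def)

text \<open>
  Lowering \<open>\<delta>\<close> to \<open>- e\<close> only relaxes the constraints; what remains is to divide the budget
  \<open>x0 \<bullet> v \<le> 1 + e\<close> by \<open>1 + e\<close>, which the homogeneous constraints survive.
\<close>

lemma delta_lp_imp_efficiency_lp:
  assumes "(\<delta>, u, v) \<in> delta_lp x0 y0 X Y" and "- e \<le> \<delta>" and "0 < e"
  shows "(u /\<^sub>R (1 + e), v /\<^sub>R (1 + e)) \<in> efficiency_lp x0 X Y"
    and "1 - 2 * e \<le> y0 \<bullet> (u /\<^sub>R (1 + e))"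
proof -
  from assms(1) have u: "1 + \<delta> \<le> y0 \<bullet> u" and v: "x0 \<bullet> v \<le> 1 - \<delta>"
    and cone: "Y *v u - X *v v \<le> 0" "0 \<le> u" "0 \<le> v"
    by (auto simp: delta_lp_def)
  have "Y *v (u /\<^sub>R (1 + e)) - X *v (v /\<^sub>R (1 + e)) = (Y *v u - X *v v) /\<^sub>R (1 + e)"
    by (simp add: matrix_vector_mult_scaleR scaleR_diff_right)
  also have "\<dots> \<le> 0"
    using cone(1) \<open>0 < e\<close> by (simp add: less_eq_vec_def mult_nonneg_nonpos)
  finally have "Y *v (u /\<^sub>R (1 + e)) - X *v (v /\<^sub>R (1 + e)) \<le> 0" .
  moreover have "0 \<le> u /\<^sub>R (1 + e)" "0 \<le> v /\<^sub>R (1 + e)"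
    using cone(2,3) \<open>0 < e\<close> by (simp_all add: less_eq_vec_def)
  moreover have "x0 \<bullet> (v /\<^sub>R (1 + e)) \<le> 1"
    using v assms(2,3) by (simp add: field_simps)
  ultimately show "(u /\<^sub>R (1 + e), v /\<^sub>R (1 + e)) \<in> efficiency_lp x0 X Y"
    by (simp add: efficiency_lp_def)
  have "(1 - 2 * e) * (1 + e) \<le> 1 - e"
    by (simp add: algebra_simps)
  also have "\<dots> \<le> y0 \<bullet> u"
    using u assms(2) by linarith
  finally show "1 - 2 * e \<le> y0 \<bullet> (u /\<^sub>R (1 + e))"
    using \<open>0 < e\<close> by (simp add: pos_le_divide_eq divide_inverse_commute[symmetric])
qed

lemma delta_star_nonneg_iff_efficient:
  "0 \<le> delta_star x0 y0 X Y \<longleftrightarrow> efficient x0 y0 X Y"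
proof -
  have "0 \<le> delta_star x0 y0 X Y \<longleftrightarrow>
      (\<forall>e>0. \<exists>(\<delta>, u, v)\<in>delta_lp x0 y0 X Y. - e \<le> \<delta>)"
    using le_opt_value_iff[of 0 "delta_lp x0 y0 X Y" "\<lambda>(\<delta>, u, v). \<delta>"]
    by (simp add: delta_star_def zero_ereal_def case_prod_unfold)
  also have "\<dots> \<longleftrightarrow> (\<forall>e>0. \<exists>(u, v)\<in>efficiency_lp x0 X Y. 1 - e \<le> y0 \<bullet> u)"
  proof (intro iffI allI impI)
    fix e :: real
    assume "\<forall>e>0. \<exists>(\<delta>, u, v)\<in>delta_lp x0 y0 X Y. - e \<le> \<delta>" and "0 < e"
    \<comment> \<open>Rescaling doubles the error in the output value, hence the choice of \<open>e / 2\<close>.\<close>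
    then obtain \<delta> u v where "(\<delta>, u, v) \<in> delta_lp x0 y0 X Y" "- (e / 2) \<le> \<delta>"
      by (fastforce dest: spec[of _ "e / 2"])
    from delta_lp_imp_efficiency_lp[OF this] \<open>0 < e\<close>
    show "\<exists>(u, v)\<in>efficiency_lp x0 X Y. 1 - e \<le> y0 \<bullet> u"
      by (intro bexI[of _ "(u /\<^sub>R (1 + e / 2), v /\<^sub>R (1 + e / 2))"]) auto
  next
    fix e :: real
    assume "\<forall>e>0. \<exists>(u, v)\<in>efficiency_lp x0 X Y. 1 - e \<le> y0 \<bullet> u" and "0 < e"
    then obtain u v where "(u, v) \<in> efficiency_lp x0 X Y" "1 - e \<le> y0 \<bullet> u"
      by blast
    with \<open>0 < e\<close> have "(- e, u, v) \<in> delta_lp x0 y0 X Y"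
      by (simp add: efficiency_lp_imp_delta_lp)
    then show "\<exists>(\<delta>, u, v)\<in>delta_lp x0 y0 X Y. - e \<le> \<delta>"
      by blast
  qed
  also have "\<dots> \<longleftrightarrow> efficient x0 y0 X Y"
    using le_opt_value_iff[of 1 "efficiency_lp x0 X Y" "\<lambda>(u, v). y0 \<bullet> u"]
    by (simp add: efficient_def one_ereal_def case_prod_unfold)
  finally show ?thesis .
qed

lemma delta_star_ge_neg_one: "- 1 \<le> delta_star x0 y0 X Y"
proof -
  have "(- 1, 0, 0) \<in> delta_lp x0 y0 X Y"
    by (simp add: delta_lp_def)
  then have "ereal (- 1) \<le> delta_star x0 y0 X Y"
    unfolding delta_star_def opt_value_def by (rule SUP_upper2) simp
  then show ?thesis
    by (simp add: one_ereal_def)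
qed

lemma delta_star_le_one:
  assumes "0 \<le> x0"
  shows "delta_star x0 y0 X Y \<le> 1"
  unfolding delta_star_def opt_value_def
proof (rule SUP_least)
  fix z
  assume "z \<in> delta_lp x0 y0 X Y"
  then obtain \<delta> u v where z: "z = (\<delta>, u, v)" and "x0 \<bullet> v \<le> 1 - \<delta>" and "0 \<le> v"
    by (auto simp: delta_lp_def)
  moreover have "0 \<le> x0 \<bullet> v"
    using assms \<open>0 \<le> v\<close> by (simp add: inner_vec_def less_eq_vec_def sum_nonneg)
  ultimately show "ereal (case z of (\<delta>, u, v) \<Rightarrow> \<delta>) \<le> 1"
    by (simp add: one_ereal_def)
qed

theorem proposition1:
  fixes x0 :: "real ^ 'n1" and y0 :: "real ^ 'n2"
    and X :: "real ^ 'n1 ^ 'm" and Y :: "real ^ 'n2 ^ 'm"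
    and r :: ereal
  assumes "0 \<le> x0" and "0 \<le> y0" and "0 \<le> X" and "0 \<le> Y"
    and "r = 1 + delta_star x0 y0 X Y"
  shows "r \<in> {0..2} \<and>
         (r \<ge> 1 \<longleftrightarrow> efficient x0 y0 X Y) \<and>
         (r < 1 \<longleftrightarrow> inefficient x0 y0 X Y)"
proof -
  have bounds: "- 1 \<le> delta_star x0 y0 X Y" "delta_star x0 y0 X Y \<le> 1"
    using delta_star_ge_neg_one delta_star_le_one[OF assms(1)] by auto
  then obtain d where d: "delta_star x0 y0 X Y = ereal d"
    by (cases "delta_star x0 y0 X Y") auto
  with assms(5) have r: "r = ereal (1 + d)"
    by (simp add: one_ereal_def)
  have "r \<in> {0..2}"
    using bounds unfolding d r by (simp add: one_ereal_def)
  moreover have eff: "1 \<le> r \<longleftrightarrow> efficient x0 y0 X Y"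
    using delta_star_nonneg_iff_efficient[of x0 y0 X Y] unfolding d r by (simp add: one_ereal_def)
  moreover have "r < 1 \<longleftrightarrow> inefficient x0 y0 X Y"
    unfolding inefficient_def eff[symmetric] by (rule not_le[symmetric])
  ultimately show ?thesis
    by blast
qed

end
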